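(* Let $I$ be a finite set and let $\pi,\rho\in S(I)$. Then the following are equivalent: 1. $\pi$ and $\rho$ have an upper bound (with respect to $\preceq$); 2. $\pi$ and $\rho$ have an upper bound $\sigma$ such that $\Pi(\pi)\vee\Pi(\rho)=\Pi(\sigma)$; 3. $\pi$ and $\rho$ have an upper bound lying on a geodesic between $\pi$ and $\rho$; 4. $\pi$ is planar on $\rho^{-1}$.
   Context: $S(I)$ is the group of permutations of $I$, $\#(\cdot)$ is the number of orbits of a permutation or blocks of a set partition, $\Pi(\pi)$ is the partition of $I$ into the orbits of $\pi$, and $\vee$ is the join in the lattice of set partitions of $I$ ordered by refinement. Poset: multiplying a permutation by a transposition $(a,b)$ joins the cycles containing $a$ and $b$ if these are different and splits the cycle if $a,b$ are in the same cycle. $\pi\preceq\rho$ if $\rho$ can be obtained from $\pi$ by successively joining cycles in this manner (zero or more multiplications by transpositions, each joining two cycles). An upper bound of $\pi,\rho$ is a $\sigma\in S(I)$ with $\pi\preceq\sigma$ and $\rho\preceq\sigma$. Geodesics: in the Cayley graph of $S(I)$ generated by all transpositions, two permutations are joined by an edge if one is obtained from the other by multiplying by a transposition; a geodesic between two permutations is a path of minimal length between them. The distance between $\pi$ and $\rho$ is $|I|-\#(\pi^{-1}\rho)$. Planarity: $\pi$ is planar on $\tau$ if $\#(\pi)+\#(\tau)+\#(\pi\tau)-|I|=2\,\#(\Pi(\pi)\vee\Pi(\tau))$. *)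

theory Defs
  imports "HOL-Combinatorics.Combinatorics" "HOL-Library.Disjoint_Sets"
begin

text \<open>
  The group \<open>S(I)\<close> is the set of functions \<open>\<pi>\<close> with \<open>\<pi> permutes I\<close> (the identity outside \<open>I\<close>);
  the product \<open>\<pi>\<rho>\<close> is \<open>\<pi> \<circ> \<rho>\<close>, and \<open>\<Pi>(\<pi>)\<close> is \<open>orbit_partition I \<pi>\<close>.
\<close>

definition orbit_partition :: "'a set \<Rightarrow> ('a \<Rightarrow> 'a) \<Rightarrow> 'a set set" where
  "orbit_partition I \<pi> = orbit \<pi> ` I"

definition num_orbits :: "'a set \<Rightarrow> ('a \<Rightarrow> 'a) \<Rightarrow> nat" where
  "num_orbits I \<pi> = card (orbit_partition I \<pi>)"

definition is_partition_join :: "'a set \<Rightarrow> 'a set set \<Rightarrow> 'a set set \<Rightarrow> 'a set set \<Rightarrow> bool" where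
  "is_partition_join I P Q R \<longleftrightarrow> refines I P R \<and> refines I Q R \<and>
     (\<forall>S. refines I P S \<and> refines I Q S \<longrightarrow> refines I R S)"

definition partition_join :: "'a set \<Rightarrow> 'a set set \<Rightarrow> 'a set set \<Rightarrow> 'a set set" where
  "partition_join I P Q = (THE R. is_partition_join I P Q R)"

lemma is_partition_join_unique:
  assumes "is_partition_join I P Q R" "is_partition_join I P Q R'"
  shows "R = R'"
  using assms unfolding is_partition_join_def by (meson refines_asym)

lemma is_partition_join_exists:
  assumes P: "partition_on I P" and Q: "partition_on I Q"
  shows "\<exists>R. is_partition_join I P Q R"
proof -
  define U where "U = {S. refines I P S \<and> refines I Q S}"
  have part: "partition_on I S" if "S \<in> U" for S
    using that by (auto simp: U_def refines_def)
  have "{I} - {{}} \<in> U"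
    using P Q by (auto simp: U_def refines_def partition_on_def disjoint_def)
  hence ne: "U \<noteq> {}" by blast
  have "is_partition_join I P Q (common_refinement U)"
    unfolding is_partition_join_def
  proof (intro conjI allI impI)
    show "refines I P (common_refinement U)"
      by (rule common_refinement_coarsest[OF part P _ ne]) (auto simp: U_def)
    show "refines I Q (common_refinement U)"
      by (rule common_refinement_coarsest[OF part Q _ ne]) (auto simp: U_def)
    show "refines I (common_refinement U) S" if "refines I P S \<and> refines I Q S" for S
      by (rule refines_common_refinement[OF part]) (use that in \<open>auto simp: U_def\<close>)
  qed
  thus ?thesis ..
qed

lemma partition_join:
  assumes "partition_on I P" "partition_on I Q"
  shows "is_partition_join I P Q (partition_join I P Q)"
  unfolding partition_join_def
  using is_partition_join_exists[OF assms] is_partition_join_unique by (metis theI')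

text \<open>
  Transpositions are multiplied on the right.  Since \<open>(\<pi> a, \<pi> b) \<circ> \<pi> = \<pi> \<circ> (a, b)\<close>, and \<open>\<pi> a\<close>, \<open>\<pi> b\<close>
  lie in the cycles of \<open>a\<close>, \<open>b\<close>, multiplication on the left gives the same relations.
\<close>

definition join_step :: "'a set \<Rightarrow> ('a \<Rightarrow> 'a) \<Rightarrow> ('a \<Rightarrow> 'a) \<Rightarrow> bool" where
  "join_step I \<pi> \<rho> \<longleftrightarrow>
     (\<exists>a\<in>I. \<exists>b\<in>I. orbit \<pi> a \<noteq> orbit \<pi> b \<and> \<rho> = \<pi> \<circ> transpose a b)"

definition join_le :: "'a set \<Rightarrow> ('a \<Rightarrow> 'a) \<Rightarrow> ('a \<Rightarrow> 'a) \<Rightarrow> bool" where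
  "join_le I = (join_step I)\<^sup>*\<^sup>*"

definition is_upper_bound :: "'a set \<Rightarrow> ('a \<Rightarrow> 'a) \<Rightarrow> ('a \<Rightarrow> 'a) \<Rightarrow> ('a \<Rightarrow> 'a) \<Rightarrow> bool" where
  "is_upper_bound I \<pi> \<rho> \<sigma> \<longleftrightarrow> \<sigma> permutes I \<and> join_le I \<pi> \<sigma> \<and> join_le I \<rho> \<sigma>"

definition cayley_adj :: "'a set \<Rightarrow> ('a \<Rightarrow> 'a) \<Rightarrow> ('a \<Rightarrow> 'a) \<Rightarrow> bool" where
  "cayley_adj I \<pi> \<rho> \<longleftrightarrow> (\<exists>a\<in>I. \<exists>b\<in>I. a \<noteq> b \<and> \<rho> = \<pi> \<circ> transpose a b)"

text \<open>
  Paths are lists of vertices.  Repeated vertices need not be excluded, as a path of minimal length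
  has none.
\<close>

definition cayley_path ::
  "'a set \<Rightarrow> ('a \<Rightarrow> 'a) \<Rightarrow> ('a \<Rightarrow> 'a) \<Rightarrow> ('a \<Rightarrow> 'a) list \<Rightarrow> bool" where
  "cayley_path I \<pi> \<rho> p \<longleftrightarrow> p \<noteq> [] \<and> hd p = \<pi> \<and> last p = \<rho> \<and>
     (\<forall>\<tau>\<in>set p. \<tau> permutes I) \<and> successively (cayley_adj I) p"

definition is_geodesic ::
  "'a set \<Rightarrow> ('a \<Rightarrow> 'a) \<Rightarrow> ('a \<Rightarrow> 'a) \<Rightarrow> ('a \<Rightarrow> 'a) list \<Rightarrow> bool" where
  "is_geodesic I \<pi> \<rho> p \<longleftrightarrow> cayley_path I \<pi> \<rho> p \<and>
     (\<forall>q. cayley_path I \<pi> \<rho> q \<longrightarrow> length p \<le> length q)"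

definition planar_on :: "'a set \<Rightarrow> ('a \<Rightarrow> 'a) \<Rightarrow> ('a \<Rightarrow> 'a) \<Rightarrow> bool" where
  "planar_on I \<pi> \<tau> \<longleftrightarrow>
     int (num_orbits I \<pi>) + int (num_orbits I \<tau>) + int (num_orbits I (\<pi> \<circ> \<tau>)) - int (card I)
       = 2 * int (card (partition_join I (orbit_partition I \<pi>) (orbit_partition I \<tau>)))"

end

theory Submission
  imports Defs
begin

text \<open>
  Write \<open>#(\<pi>)\<close> for the number of orbits and \<open>d(\<pi>, \<rho>) = |I| - #(\<rho>\<^sup>-\<^sup>1\<pi>)\<close>.  Multiplication by a
  transposition changes \<open>#\<close> by exactly one, down if two cycles are joined and up if one is split.
  Hence \<open>d\<close> is the distance in the Cayley graph, \<open>#\<close> changes by at most \<open>d(\<pi>, \<sigma>)\<close> between \<open>\<pi>\<close> and \<open>\<sigma>\<close>, and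
  \<open>\<pi> \<preceq> \<sigma>\<close> holds if and only if \<open>#(\<pi>) = #(\<sigma>) + d(\<pi>, \<sigma>)\<close> (lemma \<open>join_le_iff_dist\<close>): a shortest path
  that loses one orbit per step consists of joins only.  With \<open>J = \<Pi>(\<pi>) \<or> \<Pi>(\<rho>)\<close>, planarity of
  \<open>\<pi>\<close> on \<open>\<rho>\<^sup>-\<^sup>1\<close> becomes the equation \<open>d(\<pi>, \<rho>) + 2 #(J) = #(\<pi>) + #(\<rho>)\<close>.

  The proof rests on two constructions.  First (\<open>geodesic_point_over_join\<close>), any \<open>\<pi>\<close> and \<open>\<rho>\<close>, planar
  or not, admit a \<open>\<sigma>\<close> on a geodesic between them with \<open>\<pi> \<preceq> \<sigma>\<close> and \<open>\<Pi>(\<sigma>) = J\<close>: as long as \<open>\<rho>\<close> leaves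
  some orbit of \<open>\<pi>\<close>, there is a transposition that joins two cycles of \<open>\<pi>\<close> inside a block of \<open>J\<close> and
  at the same time moves \<open>\<pi>\<close> closer to \<open>\<rho>\<close>.  Then \<open>d(\<pi>, \<rho>) = #(\<pi>) - #(J) + d(\<sigma>, \<rho>)\<close>, and
  \<open>d(\<sigma>, \<rho>) \<ge> #(\<rho>) - #(J)\<close> with equality if and only if \<open>\<rho> \<preceq> \<sigma>\<close>.  So \<open>\<ge>\<close> always holds in the planarity
  equation (\<open>genus_inequality\<close>), and \<open>\<pi>\<close> is planar on \<open>\<rho>\<^sup>-\<^sup>1\<close> if and only if this particular \<open>\<sigma>\<close> is an
  upper bound; it then witnesses (1), (2) and (3) at once.

  Second (\<open>upper_bound_imp_genus_equality\<close>), an arbitrary upper bound forces planarity.  This is an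
  induction along a chain of joins from \<open>\<pi>\<close> up to the bound: at the top \<open>\<rho> \<preceq> \<pi>\<close> and the equation is the
  distance formula for \<open>\<preceq>\<close>, and undoing one join preserves the equation.
\<close>

section \<open>Partitions\<close>

lemma block_unique:
  assumes "partition_on I P" "X \<in> P" "Y \<in> P" "x \<in> X" "x \<in> Y"
  shows "X = Y"
  using partition_onD2[OF assms(1)] assms(2-5) by (auto simp: disjoint_def)

text \<open>
  Choosing for each coarse block a fine block inside it is injective.
\<close>
lemma refines_card_le:
  assumes "finite I" "refines I P Q"
  shows "card Q \<le> card P"
proof -
  have P: "partition_on I P" and Q: "partition_on I Q" and PQ: "\<forall>X\<in>P. \<exists>Y\<in>Q. X \<subseteq> Y"
    using assms(2) by (auto simp: refines_def)
  have "\<exists>X. X \<in> P \<and> X \<subseteq> Y" if Y: "Y \<in> Q" for Y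
  proof -
    have "Y \<noteq> {}" using partition_onD3[OF Q] Y by auto
    then obtain y where y: "y \<in> Y" by blast
    then obtain X where X: "X \<in> P" "y \<in> X"
      using partition_onD1[OF P] partition_onD1[OF Q] Y by blast
    then obtain Y' where Y': "Y' \<in> Q" "X \<subseteq> Y'" using PQ by blast
    then have "Y' = Y" using block_unique[OF Q] Y X(2) y by blast
    with X Y' show ?thesis by blast
  qed
  then obtain f where f: "\<And>Y. Y \<in> Q \<Longrightarrow> f Y \<in> P \<and> f Y \<subseteq> Y" by metis
  have "inj_on f Q"
  proof (rule inj_onI)
    fix Y Y' assume Y: "Y \<in> Q" "Y' \<in> Q" "f Y = f Y'"
    then have "f Y \<subseteq> Y" "f Y \<subseteq> Y'" "f Y \<noteq> {}"
      using f[of Y] f[of Y'] partition_onD3[OF P] by auto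
    then show "Y = Y'"
      using block_unique[OF Q Y(1,2)] by blast
  qed
  moreover have "f ` Q \<subseteq> P" using f by blast
  moreover have "finite P" using assms(1) P by (simp add: finite_elements)
  ultimately show ?thesis by (metis card_inj_on_le)
qed

lemma merge_blocks:
  assumes "finite I" "partition_on I P" "A \<in> P" "B \<in> P" "A \<noteq> B"
  shows "refines I P (insert (A \<union> B) (P - {A, B}))"
    and "Suc (card (insert (A \<union> B) (P - {A, B}))) = card P"
proof -
  let ?P' = "insert (A \<union> B) (P - {A, B})"
  have fin: "finite P" using assms(1,2) by (simp add: finite_elements)
  have ne: "A \<noteq> {}" "B \<noteq> {}" using assms partition_onD3 by metis+
  have dis: "X \<inter> Y = {}" if "X \<in> P" "Y \<in> P" "X \<noteq> Y" for X Y
    using partition_onD2[OF assms(2)] that by (auto simp: disjoint_def)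
  have new: "A \<union> B \<notin> P - {A, B}"
    using dis[of A "A \<union> B"] assms ne by auto
  have "partition_on I ?P'"
  proof (rule partition_onI)
    show "\<Union>?P' = I" using partition_onD1[OF assms(2)] assms(3,4) by auto
    show "disjnt X Y" if "X \<in> ?P'" "Y \<in> ?P'" "X \<noteq> Y" for X Y
      using that dis assms(3,4) unfolding disjnt_def by blast
    show "{} \<notin> ?P'" using partition_onD3[OF assms(2)] ne by auto
  qed
  moreover have "\<exists>Y\<in>?P'. X \<subseteq> Y" if "X \<in> P" for X
    using that by (cases "X \<in> {A, B}") auto
  ultimately show "refines I P ?P'"
    using assms(2) by (simp add: refines_def)
  have "card ?P' = Suc (card (P - {A, B}))" using fin new by simp
  moreover have "card (P - {A, B}) = card P - 2"
    using assms by (subst card_Diff_subset) auto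
  moreover have "card {A, B} \<le> card P"
    using fin assms by (intro card_mono) auto
  ultimately show "Suc (card ?P') = card P" using assms(5) by simp
qed

text \<open>
  Joining cycles of \<open>\<pi>\<close> within blocks of \<open>\<Pi>(\<pi>) \<or> \<Pi>(\<rho>)\<close> leaves this join unchanged.
\<close>
lemma partition_join_coarsen_left:
  assumes "is_partition_join I P Q R" "refines I P P'" "refines I P' R"
  shows "is_partition_join I P' Q R"
  using assms unfolding is_partition_join_def by (meson refines_trans)

section \<open>Orbit partitions\<close>

lemma self_in_orbit:
  assumes "finite I" "\<pi> permutes I"
  shows "x \<in> orbit \<pi> x"
  using assms by (meson permutation_permutes permutation_self_in_orbit)

lemma orbit_eq_iff:
  assumes "finite I" "\<pi> permutes I"
  shows "orbit \<pi> x = orbit \<pi> y \<longleftrightarrow> y \<in> orbit \<pi> x"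
  using self_in_orbit[OF assms] cyclic_on_orbit[OF assms(2,1)]
  by (metis orbit_cyclic_eq3)

lemma orbit_apply:
  assumes "finite I" "\<pi> permutes I"
  shows "orbit \<pi> (\<pi> x) = orbit \<pi> x"
  using orbit_eq_iff[OF assms] orbit.base by metis

lemma partition_on_orbits:
  assumes "finite I" "\<pi> permutes I"
  shows "partition_on I (orbit_partition I \<pi>)"
  unfolding orbit_partition_def
proof (rule partition_onI)
  show "\<Union> (orbit \<pi> ` I) = I"
    using self_in_orbit[OF assms] permutes_orbit_subset[OF assms(2)] by blast
  show "disjnt p q" if "p \<in> orbit \<pi> ` I" "q \<in> orbit \<pi> ` I" "p \<noteq> q" for p q
    using that orbit_eq_iff[OF assms] unfolding disjnt_iff by (metis imageE)
  show "{} \<notin> orbit \<pi> ` I" using orbit_nonempty by (metis imageE)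
qed

lemma num_orbits_le_card: "finite I \<Longrightarrow> num_orbits I \<pi> \<le> card I"
  unfolding num_orbits_def orbit_partition_def by (rule card_image_le)

lemma num_orbits_eq_card_iff:
  assumes "finite I" "\<pi> permutes I"
  shows "num_orbits I \<pi> = card I \<longleftrightarrow> \<pi> = id"
proof
  assume "num_orbits I \<pi> = card I"
  then have "inj_on (orbit \<pi>) I"
    unfolding num_orbits_def orbit_partition_def by (rule eq_card_imp_inj_on[OF assms(1)])
  then have "\<pi> x = x" for x
    using orbit_apply[OF assms, of x] permutes_in_image[OF assms(2), of x] assms(2)
    by (metis inj_onD permutes_not_in)
  then show "\<pi> = id" by auto
next
  assume "\<pi> = id"
  moreover have "orbit id x = {x}" for x :: 'a by (simp add: orbit_eq_singleton_iff)
  ultimately show "num_orbits I \<pi> = card I"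
    unfolding num_orbits_def orbit_partition_def by (simp add: card_image)
qed

lemma orbit_partition_inv:
  assumes "finite I" "\<pi> permutes I"
  shows "orbit_partition I (inv \<pi>) = orbit_partition I \<pi>"
proof -
  have "permutation \<pi>" using assms by (auto simp: permutation_permutes)
  then show ?thesis by (simp add: orbit_partition_def orbit_inv_eq)
qed

text \<open>
  The two products are conjugate by \<open>\<tau>\<close>, which maps the orbits of one onto those of the other.
\<close>
lemma num_orbits_comp_commute:
  assumes "finite I" "\<pi> permutes I" "\<tau> permutes I"
  shows "num_orbits I (\<pi> \<circ> \<tau>) = num_orbits I (\<tau> \<circ> \<pi>)"
proof -
  have eq: "\<tau> ` orbit (\<pi> \<circ> \<tau>) x = orbit (\<tau> \<circ> \<pi>) (\<tau> x)" for x
    using self_in_orbit[OF assms(1) permutes_compose[OF assms(3,2)]]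
    by (rule orbit_inverse) simp
  have "orbit_partition I (\<tau> \<circ> \<pi>) = orbit (\<tau> \<circ> \<pi>) ` \<tau> ` I"
    unfolding orbit_partition_def using permutes_image[OF assms(3)] by simp
  also have "\<dots> = (\<lambda>B. \<tau> ` B) ` orbit_partition I (\<pi> \<circ> \<tau>)"
    unfolding orbit_partition_def by (simp add: image_image eq)
  finally show ?thesis
    unfolding num_orbits_def using permutes_inj[OF assms(3)]
    by (metis card_image inj_image_eq_iff inj_onI)
qed

text \<open>
  This reduces refinement to stability of blocks under one application of \<open>\<pi>\<close>, a condition that
  passes to products.
\<close>
lemma orbit_partition_refines_iff:
  assumes "finite I" "\<pi> permutes I" "partition_on I R"
  shows "refines I (orbit_partition I \<pi>) R \<longleftrightarrow> (\<forall>B\<in>R. \<forall>x\<in>B. \<pi> x \<in> B)"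
proof
  assume ref: "refines I (orbit_partition I \<pi>) R"
  show "\<forall>B\<in>R. \<forall>x\<in>B. \<pi> x \<in> B"
  proof (intro ballI)
    fix B x assume B: "B \<in> R" "x \<in> B"
    then have "x \<in> I" using partition_onD1[OF assms(3)] by blast
    then obtain B' where B': "B' \<in> R" "orbit \<pi> x \<subseteq> B'"
      using ref unfolding refines_def orbit_partition_def by blast
    then have "x \<in> B'" "\<pi> x \<in> B'" using self_in_orbit[OF assms(1,2)] orbit.base by fast+
    then show "\<pi> x \<in> B"
      using B B' block_unique[OF assms(3)] by metis
  qed
next
  assume clo: "\<forall>B\<in>R. \<forall>x\<in>B. \<pi> x \<in> B"
  have "\<exists>B\<in>R. orbit \<pi> x \<subseteq> B" if x: "x \<in> I" for x
  proof -
    obtain B where B: "B \<in> R" "x \<in> B" using x partition_onD1[OF assms(3)] by blast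
    have "y \<in> B" if "y \<in> orbit \<pi> x" for y
      using that by induction (use B clo in auto)
    then show ?thesis using B by blast
  qed
  then show "refines I (orbit_partition I \<pi>) R"
    unfolding refines_def using assms(3) partition_on_orbits[OF assms(1,2)]
    by (auto simp: orbit_partition_def)
qed

lemma refines_orbits_comp:
  assumes "finite I" "\<pi> permutes I" "\<tau> permutes I"
    and "refines I (orbit_partition I \<pi>) R" "refines I (orbit_partition I \<tau>) R"
  shows "refines I (orbit_partition I (\<pi> \<circ> \<tau>)) R"
proof -
  have R: "partition_on I R" using assms(4) by (simp add: refines_def)
  show ?thesis
    using assms(4,5) unfolding orbit_partition_refines_iff[OF assms(1,2) R]
      orbit_partition_refines_iff[OF assms(1,3) R]
      orbit_partition_refines_iff[OF assms(1) permutes_compose[OF assms(3,2)] R]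
    by simp
qed

lemma refines_orbits_transpose:
  assumes "finite I" "partition_on I R" "B \<in> R" "a \<in> B" "b \<in> B"
  shows "refines I (orbit_partition I (transpose a b)) R"
proof -
  have "a \<in> I" "b \<in> I" using partition_onD1[OF assms(2)] assms by auto
  then have t: "transpose a b permutes I" by (rule permutes_swap_id)
  have "a \<in> X \<longleftrightarrow> b \<in> X" if "X \<in> R" for X
    using block_unique[OF assms(2) assms(3) that] assms(4,5) by blast
  then have "\<forall>X\<in>R. \<forall>x\<in>X. transpose a b x \<in> X"
    unfolding transpose_def by (metis (full_types))
  then show ?thesis
    using orbit_partition_refines_iff[OF assms(1) t assms(2)] by blast
qed

section \<open>Multiplication by a transposition\<close>

lemma permutes_comp_transpose:
  "\<pi> permutes I \<Longrightarrow> a \<in> I \<Longrightarrow> b \<in> I \<Longrightarrow> \<pi> \<circ> transpose a b permutes I"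
  by (simp add: permutes_compose permutes_swap_id)

text \<open>
  After the modification, the walk along the old cycle of \<open>b\<close> starts at the image of \<open>a\<close>, runs
  undisturbed until it reaches \<open>b\<close>, and continues with the old cycle of \<open>a\<close>.
\<close>
lemma orbit_partition_comp_transpose:
  assumes "finite I" "\<pi> permutes I" "a \<in> I" "b \<in> I" "orbit \<pi> a \<noteq> orbit \<pi> b"
  shows "orbit_partition I (\<pi> \<circ> transpose a b) =
    insert (orbit \<pi> a \<union> orbit \<pi> b) (orbit_partition I \<pi> - {orbit \<pi> a, orbit \<pi> b})"
proof -
  let ?\<sigma> = "\<pi> \<circ> transpose a b"
  have \<sigma>: "?\<sigma> permutes I" using assms by (intro permutes_comp_transpose)
  note eqp = orbit_eq_iff[OF assms(1,2)] and eqs = orbit_eq_iff[OF assms(1) \<sigma>]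
  note selfp = self_in_orbit[OF assms(1,2)]
  have ab: "a \<noteq> b" using assms(5) by auto
  have anb: "a \<notin> orbit \<pi> b" "b \<notin> orbit \<pi> a" using assms(5) eqp by metis+
  have sub: "orbit \<pi> v \<subseteq> orbit (\<pi> \<circ> transpose u v) u" if "u \<notin> orbit \<pi> v" for u v
  proof
    have "(\<pi> \<circ> transpose u v) u = \<pi> v" by simp
    then have start: "\<pi> v \<in> orbit (\<pi> \<circ> transpose u v) u" using orbit.base by metis
    fix y assume "y \<in> orbit \<pi> v"
    then show "y \<in> orbit (\<pi> \<circ> transpose u v) u"
    proof induction
      case base
      show ?case by (rule start)
    next
      case (step y)
      have "y \<noteq> u" using step.hyps that by auto
      then have "\<pi> y = \<pi> v \<or> \<pi> y = (\<pi> \<circ> transpose u v) y"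
        by (cases "y = v") (auto simp: transpose_def)
      then show ?case using start orbit.step[OF step.IH] by metis
    qed
  qed
  have "orbit \<pi> b \<subseteq> orbit ?\<sigma> a" "orbit \<pi> a \<subseteq> orbit ?\<sigma> b"
    using sub[of a b] sub[of b a] anb by (simp_all add: transpose_commute)
  then have eq: "orbit ?\<sigma> a = orbit ?\<sigma> b" and le: "orbit \<pi> a \<union> orbit \<pi> b \<subseteq> orbit ?\<sigma> a"
    using eqs[of a b] selfp[of b] by blast+
  have "y \<in> orbit \<pi> a \<union> orbit \<pi> b" if "y \<in> orbit ?\<sigma> a" for y
    using that by induction (auto simp: transpose_def intro: orbit.intros)
  with le have mid: "orbit ?\<sigma> a = orbit \<pi> a \<union> orbit \<pi> b" by blast
  have other: "orbit ?\<sigma> x = orbit \<pi> x" if "x \<notin> orbit \<pi> a \<union> orbit \<pi> b" for x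
  proof (rule orbit_cong[OF selfp])
    fix s assume "s \<in> orbit \<pi> x"
    then have "s \<noteq> a" "s \<noteq> b" using that eqp[of x a] eqp[of x b] selfp[of x] by auto
    then show "?\<sigma> s = \<pi> s" by (simp add: transpose_def)
  qed
  have inside: "orbit ?\<sigma> x = orbit \<pi> a \<union> orbit \<pi> b" if "x \<in> orbit \<pi> a \<union> orbit \<pi> b" for x
    using that mid eqs by metis
  show ?thesis
  proof (intro equalityI subsetI)
    fix X assume "X \<in> orbit_partition I ?\<sigma>"
    then obtain x where x: "x \<in> I" "X = orbit ?\<sigma> x" by (auto simp: orbit_partition_def)
    show "X \<in> insert (orbit \<pi> a \<union> orbit \<pi> b) (orbit_partition I \<pi> - {orbit \<pi> a, orbit \<pi> b})"
    proof (cases "x \<in> orbit \<pi> a \<union> orbit \<pi> b")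
      case False
      then show ?thesis using x other[OF False] selfp[of x] by (auto simp: orbit_partition_def)
    qed (use x inside in auto)
  next
    fix X assume X: "X \<in> insert (orbit \<pi> a \<union> orbit \<pi> b) (orbit_partition I \<pi> - {orbit \<pi> a, orbit \<pi> b})"
    show "X \<in> orbit_partition I ?\<sigma>"
    proof (cases "X = orbit \<pi> a \<union> orbit \<pi> b")
      case True
      then show ?thesis using mid assms(3) by (auto simp: orbit_partition_def)
    next
      case False
      then obtain x where x: "x \<in> I" "X = orbit \<pi> x" "orbit \<pi> x \<noteq> orbit \<pi> a" "orbit \<pi> x \<noteq> orbit \<pi> b"
        using X by (auto simp: orbit_partition_def)
      then have "x \<notin> orbit \<pi> a \<union> orbit \<pi> b" using eqp by (metis UnE)
      from other[OF this] have "X = orbit ?\<sigma> x" using x(2) by simp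
      with x(1) show ?thesis unfolding orbit_partition_def by blast
    qed
  qed
qed

lemma join_num_orbits:
  assumes "finite I" "\<pi> permutes I" "a \<in> I" "b \<in> I" "orbit \<pi> a \<noteq> orbit \<pi> b"
  shows "num_orbits I \<pi> = Suc (num_orbits I (\<pi> \<circ> transpose a b))"
    and "refines I (orbit_partition I \<pi>) (orbit_partition I (\<pi> \<circ> transpose a b))"
  using merge_blocks[OF assms(1) partition_on_orbits[OF assms(1,2)], of "orbit \<pi> a" "orbit \<pi> b"] assms
  unfolding orbit_partition_comp_transpose[OF assms] num_orbits_def
  by (auto simp: orbit_partition_def)

text \<open>
  If \<open>k\<close> is the first exponent with \<open>\<pi>\<^sup>k a = b\<close>, then the arc \<open>S\<close> of the points
  \<open>\<pi> a, \<dots>, \<pi>\<^sup>k a\<close> closes up: the new permutation sends its last point \<open>b\<close> back to \<open>\<pi> a\<close>.  It does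
  not contain \<open>a\<close>.
\<close>
lemma split_orbits_differ:
  assumes "finite I" "\<pi> permutes I" "a \<in> I" "b \<in> I" "a \<noteq> b" "orbit \<pi> a = orbit \<pi> b"
  shows "orbit (\<pi> \<circ> transpose a b) a \<noteq> orbit (\<pi> \<circ> transpose a b) b"
proof -
  let ?\<sigma> = "\<pi> \<circ> transpose a b"
  have \<sigma>: "?\<sigma> permutes I" using assms by (intro permutes_comp_transpose)
  have b: "b \<in> orbit \<pi> a" using orbit_eq_iff[OF assms(1,2)] assms(6) by metis
  let ?k = "funpow_dist \<pi> a b"
  have k: "(\<pi> ^^ ?k) a = b" using b by (rule funpow_dist_prop)
  have inj: "(\<pi> ^^ m) a \<noteq> (\<pi> ^^ n) a" if "m \<le> ?k" "n \<le> ?k" "m \<noteq> n" for m n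
    using funpow_neq_less_funpow_dist[OF b that] .
  define S where "S = {(\<pi> ^^ i) a | i. 0 < i \<and> i \<le> ?k}"
  have k0: "?k \<noteq> 0" using k assms(5) by (metis funpow_0)
  have aS: "a \<notin> S" using inj[of _ 0] unfolding S_def by fastforce
  have closed: "?\<sigma> y \<in> S" if y: "y \<in> S" for y
  proof -
    obtain i where i: "y = (\<pi> ^^ i) a" "0 < i" "i \<le> ?k" using y by (auto simp: S_def)
    show ?thesis
    proof (cases "i = ?k")
      case True
      then have "?\<sigma> y = (\<pi> ^^ 1) a" using i k by simp
      then show ?thesis unfolding S_def using k0 by (auto intro!: exI[of _ 1])
    next
      case False
      then have "y \<noteq> b" "y \<noteq> a" using inj[of i ?k] i k y aS by auto
      then have "?\<sigma> y = (\<pi> ^^ Suc i) a" using i by (simp add: transpose_def)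
      then show ?thesis unfolding S_def using i False by (auto intro!: exI[of _ "Suc i"])
    qed
  qed
  have bS: "b \<in> S" using k k0 unfolding S_def by force
  have "y \<in> S" if "y \<in> orbit ?\<sigma> b" for y
    using that by induction (use closed bS in blast)+
  then show ?thesis using aS self_in_orbit[OF assms(1) \<sigma>, of a] by auto
qed

text \<open>
  Splitting is undone by joining with the same transposition.
\<close>
lemma split_num_orbits:
  assumes "finite I" "\<pi> permutes I" "a \<in> I" "b \<in> I" "a \<noteq> b" "orbit \<pi> a = orbit \<pi> b"
  shows "num_orbits I (\<pi> \<circ> transpose a b) = Suc (num_orbits I \<pi>)"
  using join_num_orbits(1)[OF assms(1) permutes_comp_transpose[OF assms(2-4)] assms(3,4)
      split_orbits_differ[OF assms]]
  by (simp add: comp_assoc)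

section \<open>Distance in the Cayley graph\<close>

text \<open>
  The product is taken as \<open>\<rho>\<^sup>-\<^sup>1\<pi>\<close>, so that an edge \<open>\<pi> \<mapsto> \<pi> (a, b)\<close> multiplies it by \<open>(a, b)\<close>
  on the right as well.
\<close>
definition cayley_dist :: "'a set \<Rightarrow> ('a \<Rightarrow> 'a) \<Rightarrow> ('a \<Rightarrow> 'a) \<Rightarrow> nat" where
  "cayley_dist I \<pi> \<rho> = card I - num_orbits I (inv \<rho> \<circ> \<pi>)"

lemma permutes_inv_comp: "\<pi> permutes I \<Longrightarrow> \<rho> permutes I \<Longrightarrow> inv \<rho> \<circ> \<pi> permutes I"
  by (simp add: permutes_compose permutes_inv)

lemma cayley_dist_add_num_orbits:
  "finite I \<Longrightarrow> cayley_dist I \<pi> \<rho> + num_orbits I (inv \<rho> \<circ> \<pi>) = card I"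
  unfolding cayley_dist_def using num_orbits_le_card[of I] by simp

lemma cayley_dist_eq_0_iff:
  assumes "finite I" "\<pi> permutes I" "\<rho> permutes I"
  shows "cayley_dist I \<pi> \<rho> = 0 \<longleftrightarrow> \<pi> = \<rho>"
proof -
  have "cayley_dist I \<pi> \<rho> = 0 \<longleftrightarrow> inv \<rho> \<circ> \<pi> = id"
    using cayley_dist_add_num_orbits[OF assms(1), of \<pi> \<rho>]
      num_orbits_eq_card_iff[OF assms(1) permutes_inv_comp[OF assms(2,3)]] by linarith
  also have "\<dots> \<longleftrightarrow> \<pi> = \<rho>"
    using permutes_inv_o[OF assms(3)] by (metis comp_assoc comp_id id_comp)
  finally show ?thesis .
qed

lemma cayley_dist_sym:
  assumes "finite I" "\<pi> permutes I" "\<rho> permutes I"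
  shows "cayley_dist I \<pi> \<rho> = cayley_dist I \<rho> \<pi>"
proof -
  have "inv (inv \<rho> \<circ> \<pi>) = inv \<pi> \<circ> \<rho>"
    using o_inv_distrib[OF permutes_bij[OF permutes_inv[OF assms(3)]] permutes_bij[OF assms(2)]]
      permutes_inv_inv[OF assms(3)] by simp
  then have "orbit_partition I (inv \<rho> \<circ> \<pi>) = orbit_partition I (inv \<pi> \<circ> \<rho>)"
    using orbit_partition_inv[OF assms(1) permutes_inv_comp[OF assms(2,3)]] by simp
  then show ?thesis by (simp add: cayley_dist_def num_orbits_def)
qed

lemma cayley_dist_transpose:
  assumes "finite I" "\<pi> permutes I" "\<rho> permutes I" "a \<in> I" "b \<in> I" "a \<noteq> b"
  shows "orbit (inv \<rho> \<circ> \<pi>) a = orbit (inv \<rho> \<circ> \<pi>) b \<Longrightarrow>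
      cayley_dist I \<pi> \<rho> = Suc (cayley_dist I (\<pi> \<circ> transpose a b) \<rho>)"
    and "orbit (inv \<rho> \<circ> \<pi>) a \<noteq> orbit (inv \<rho> \<circ> \<pi>) b \<Longrightarrow>
      cayley_dist I (\<pi> \<circ> transpose a b) \<rho> = Suc (cayley_dist I \<pi> \<rho>)"
proof -
  note p = permutes_inv_comp[OF assms(2,3)]
  note d = cayley_dist_add_num_orbits[OF assms(1), of \<pi> \<rho>]
    cayley_dist_add_num_orbits[OF assms(1), of "\<pi> \<circ> transpose a b" \<rho>]
  show "cayley_dist I \<pi> \<rho> = Suc (cayley_dist I (\<pi> \<circ> transpose a b) \<rho>)"
    if "orbit (inv \<rho> \<circ> \<pi>) a = orbit (inv \<rho> \<circ> \<pi>) b"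
    using d split_num_orbits[OF assms(1) p assms(4-6) that] by (simp add: comp_assoc)
  show "cayley_dist I (\<pi> \<circ> transpose a b) \<rho> = Suc (cayley_dist I \<pi> \<rho>)"
    if "orbit (inv \<rho> \<circ> \<pi>) a \<noteq> orbit (inv \<rho> \<circ> \<pi>) b"
    using d join_num_orbits(1)[OF assms(1) p assms(4,5) that] by (simp add: comp_assoc)
qed

lemma cayley_adjE:
  assumes "cayley_adj I \<pi> \<sigma>"
  obtains a b where "a \<in> I" "b \<in> I" "a \<noteq> b" "\<sigma> = \<pi> \<circ> transpose a b"
  using assms unfolding cayley_adj_def by blast

lemma cayley_adj_permutes: "cayley_adj I \<pi> \<sigma> \<Longrightarrow> \<pi> permutes I \<Longrightarrow> \<sigma> permutes I"
  by (auto elim!: cayley_adjE intro: permutes_comp_transpose)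

lemma cayley_dist_le_adj:
  assumes "finite I" "\<pi> permutes I" "\<rho> permutes I" "cayley_adj I \<pi> \<pi>'"
  shows "cayley_dist I \<pi> \<rho> \<le> Suc (cayley_dist I \<pi>' \<rho>)"
proof -
  obtain a b where ab: "a \<in> I" "b \<in> I" "a \<noteq> b" "\<pi>' = \<pi> \<circ> transpose a b"
    using assms(4) by (rule cayley_adjE)
  show ?thesis
    unfolding ab(4) using cayley_dist_transpose[OF assms(1-3) ab(1-3)] by linarith
qed

lemma num_orbits_le_adj:
  assumes "finite I" "\<pi> permutes I" "cayley_adj I \<pi> \<pi>'"
  shows "num_orbits I \<pi> \<le> Suc (num_orbits I \<pi>')"
proof -
  obtain a b where ab: "a \<in> I" "b \<in> I" "a \<noteq> b" "\<pi>' = \<pi> \<circ> transpose a b"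
    using assms(3) by (rule cayley_adjE)
  show ?thesis
    unfolding ab(4)
    using join_num_orbits(1)[OF assms(1,2) ab(1,2)] split_num_orbits[OF assms(1,2) ab(1-3)]
    by linarith
qed

lemma cayley_dist_le_steps:
  assumes "finite I" "\<rho> permutes I"
  shows "(cayley_adj I ^^ n) \<pi> \<rho> \<Longrightarrow> \<pi> permutes I \<Longrightarrow> cayley_dist I \<pi> \<rho> \<le> n"
proof (induction n arbitrary: \<pi>)
  case 0
  then show ?case using cayley_dist_eq_0_iff[OF assms(1) _ assms(2)] by simp
next
  case (Suc n)
  from relpowp_Suc_D2[OF Suc.prems(1)] obtain \<pi>' where
    s: "cayley_adj I \<pi> \<pi>'" "(cayley_adj I ^^ n) \<pi>' \<rho>" by blast
  have "cayley_dist I \<pi>' \<rho> \<le> n"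
    using Suc.IH[OF s(2)] cayley_adj_permutes[OF s(1) Suc.prems(2)] by simp
  moreover have "cayley_dist I \<pi> \<rho> \<le> Suc (cayley_dist I \<pi>' \<rho>)"
    using s(1) by (rule cayley_dist_le_adj[OF assms(1) Suc.prems(2) assms(2)])
  ultimately show ?case by simp
qed

text \<open>
  Splitting a cycle of \<open>\<rho>\<^sup>-\<^sup>1\<pi>\<close> brings \<open>\<pi>\<close> one step closer to \<open>\<rho>\<close>, and a cycle of length greater
  than one exists unless \<open>\<pi> = \<rho>\<close>.
\<close>
lemma steps_of_cayley_dist:
  assumes "finite I" "\<rho> permutes I" "\<pi> permutes I"
  shows "(cayley_adj I ^^ cayley_dist I \<pi> \<rho>) \<pi> \<rho>"
  using assms(3)
proof (induction "cayley_dist I \<pi> \<rho>" arbitrary: \<pi>)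
  case 0
  then have "\<pi> = \<rho>" using cayley_dist_eq_0_iff[OF assms(1) _ assms(2)] by simp
  then show ?case unfolding 0(1)[symmetric] by simp
next
  case (Suc n)
  let ?\<kappa> = "inv \<rho> \<circ> \<pi>"
  have \<kappa>: "?\<kappa> permutes I" using Suc.prems assms(2) by (rule permutes_inv_comp)
  have "?\<kappa> \<noteq> id"
    using num_orbits_eq_card_iff[OF assms(1) \<kappa>] cayley_dist_add_num_orbits[OF assms(1), of \<pi> \<rho>]
      Suc.hyps(2) by linarith
  then obtain x where x: "?\<kappa> x \<noteq> x" by (metis eq_id_iff)
  then have xI: "x \<in> I" "?\<kappa> x \<in> I"
    using \<kappa> by (metis permutes_not_in, metis permutes_in_image permutes_not_in)
  let ?\<pi>' = "\<pi> \<circ> transpose x (?\<kappa> x)"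
  have d: "cayley_dist I \<pi> \<rho> = Suc (cayley_dist I ?\<pi>' \<rho>)"
    using cayley_dist_transpose(1)[OF assms(1) Suc.prems assms(2) xI x[symmetric]]
      orbit_apply[OF assms(1) \<kappa>, of x] by simp
  have "?\<pi>' permutes I" using Suc.prems xI by (rule permutes_comp_transpose)
  with Suc.hyps d have "(cayley_adj I ^^ cayley_dist I ?\<pi>' \<rho>) ?\<pi>' \<rho>" by simp
  moreover have "cayley_adj I \<pi> ?\<pi>'" unfolding cayley_adj_def using xI x by metis
  ultimately show ?case unfolding d by (metis relpowp_Suc_I2)
qed

lemma cayley_path_Cons:
  assumes "cayley_path I \<sigma> \<rho> p" "cayley_adj I \<pi> \<sigma>" "\<pi> permutes I"
  shows "cayley_path I \<pi> \<rho> (\<pi> # p)"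
  using assms unfolding cayley_path_def by (cases p) auto

lemma cayley_path_of_steps:
  "(cayley_adj I ^^ n) \<pi> \<rho> \<Longrightarrow> \<pi> permutes I \<Longrightarrow> \<exists>p. cayley_path I \<pi> \<rho> p \<and> length p = Suc n"
proof (induction n arbitrary: \<pi>)
  case 0
  then show ?case by (intro exI[of _ "[\<pi>]"]) (auto simp: cayley_path_def)
next
  case (Suc n)
  from relpowp_Suc_D2[OF Suc.prems(1)] obtain \<pi>' where
    s: "cayley_adj I \<pi> \<pi>'" "(cayley_adj I ^^ n) \<pi>' \<rho>" by blast
  then obtain p where "cayley_path I \<pi>' \<rho> p" "length p = Suc n"
    using Suc.IH cayley_adj_permutes[OF s(1) Suc.prems(2)] by blast
  then show ?case using cayley_path_Cons[OF _ s(1) Suc.prems(2)] by (metis length_Cons)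
qed

lemma steps_of_cayley_path:
  "cayley_path I \<pi> \<rho> p \<Longrightarrow> (cayley_adj I ^^ (length p - 1)) \<pi> \<rho>"
proof (induction p arbitrary: \<pi>)
  case Nil
  then show ?case by (simp add: cayley_path_def)
next
  case (Cons \<tau> p)
  show ?case
  proof (cases p)
    case Nil
    then show ?thesis using Cons.prems by (auto simp: cayley_path_def)
  next
    case (Cons \<upsilon> q)
    then have "cayley_path I \<upsilon> \<rho> p" "cayley_adj I \<pi> \<upsilon>"
      using Cons.prems by (auto simp: cayley_path_def)
    then show ?thesis
      using Cons.IH[of \<upsilon>] Cons relpowp_Suc_I2[of "cayley_adj I" \<pi> \<upsilon> "length p - 1" \<rho>] by simp
  qed
qed

lemma cayley_path_append:
  assumes "cayley_path I \<pi> \<sigma> p" "cayley_path I \<sigma> \<rho> (\<sigma> # q)"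
  shows "cayley_path I \<pi> \<rho> (p @ q)"
  using assms unfolding cayley_path_def
  by (cases q) (auto simp: successively_append_iff)

lemma geodesic_through:
  assumes "finite I" "\<pi> permutes I" "\<sigma> permutes I" "\<rho> permutes I"
    and "cayley_dist I \<pi> \<rho> = cayley_dist I \<pi> \<sigma> + cayley_dist I \<sigma> \<rho>"
  shows "\<exists>p. is_geodesic I \<pi> \<rho> p \<and> \<sigma> \<in> set p"
proof -
  obtain p where p: "cayley_path I \<pi> \<sigma> p" "length p = Suc (cayley_dist I \<pi> \<sigma>)"
    using cayley_path_of_steps[OF steps_of_cayley_dist] assms by blast
  obtain q' where q': "cayley_path I \<sigma> \<rho> q'" "length q' = Suc (cayley_dist I \<sigma> \<rho>)"
    using cayley_path_of_steps[OF steps_of_cayley_dist] assms by blast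
  then obtain q where q: "q' = \<sigma> # q"
    unfolding cayley_path_def by (cases q') auto
  have path: "cayley_path I \<pi> \<rho> (p @ q)" using p q' q by (auto intro: cayley_path_append)
  have "length (p @ q) \<le> length r" if r: "cayley_path I \<pi> \<rho> r" for r
  proof -
    have "r \<noteq> []" using r by (simp add: cayley_path_def)
    moreover have "cayley_dist I \<pi> \<rho> \<le> length r - 1"
      using cayley_dist_le_steps[OF assms(1,4) steps_of_cayley_path[OF r] assms(2)] .
    moreover have "length (p @ q) = Suc (cayley_dist I \<pi> \<rho>)" using p q' q assms(5) by simp
    ultimately show ?thesis by (cases r) auto
  qed
  moreover have "\<sigma> \<in> set p" using p unfolding cayley_path_def by (metis last_in_set)
  ultimately show ?thesis using path unfolding is_geodesic_def by auto
qed

section \<open>The order in terms of the distance\<close>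

lemma join_step_imp:
  assumes "finite I" "\<pi> permutes I" "join_step I \<pi> \<sigma>"
  shows "cayley_adj I \<pi> \<sigma>" "\<sigma> permutes I" "num_orbits I \<pi> = Suc (num_orbits I \<sigma>)"
    "refines I (orbit_partition I \<pi>) (orbit_partition I \<sigma>)"
proof -
  obtain a b where ab: "a \<in> I" "b \<in> I" "orbit \<pi> a \<noteq> orbit \<pi> b" "\<sigma> = \<pi> \<circ> transpose a b"
    using assms(3) unfolding join_step_def by blast
  then show adj: "cayley_adj I \<pi> \<sigma>" unfolding cayley_adj_def by metis
  show "\<sigma> permutes I" using cayley_adj_permutes[OF adj assms(2)] .
  show "num_orbits I \<pi> = Suc (num_orbits I \<sigma>)"
    "refines I (orbit_partition I \<pi>) (orbit_partition I \<sigma>)"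
    using join_num_orbits[OF assms(1,2) ab(1-3)] ab(4) by simp_all
qed

lemma num_orbits_le_steps:
  assumes "finite I"
  shows "(cayley_adj I ^^ n) \<pi> \<sigma> \<Longrightarrow> \<pi> permutes I \<Longrightarrow> num_orbits I \<pi> \<le> num_orbits I \<sigma> + n"
proof (induction n arbitrary: \<pi>)
  case (Suc n)
  from relpowp_Suc_D2[OF Suc.prems(1)] obtain \<pi>' where
    s: "cayley_adj I \<pi> \<pi>'" "(cayley_adj I ^^ n) \<pi>' \<sigma>" by blast
  have "num_orbits I \<pi>' \<le> num_orbits I \<sigma> + n"
    using Suc.IH[OF s(2)] cayley_adj_permutes[OF s(1) Suc.prems(2)] by simp
  moreover have "num_orbits I \<pi> \<le> Suc (num_orbits I \<pi>')"
    using s(1) by (rule num_orbits_le_adj[OF assms Suc.prems(2)])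
  ultimately show ?case by simp
qed simp

lemma num_orbits_le_dist:
  assumes "finite I" "\<pi> permutes I" "\<sigma> permutes I"
  shows "num_orbits I \<pi> \<le> num_orbits I \<sigma> + cayley_dist I \<pi> \<sigma>"
  using num_orbits_le_steps[OF assms(1) steps_of_cayley_dist[OF assms(1,3,2)] assms(2)] .

text \<open>
  A step loses at most one orbit.  If \<open>n\<close> steps lose \<open>n\<close> orbits, none of them can be a split.
\<close>
lemma join_le_of_steps:
  assumes "finite I"
  shows "(cayley_adj I ^^ n) \<pi> \<sigma> \<Longrightarrow> \<pi> permutes I \<Longrightarrow> num_orbits I \<pi> = num_orbits I \<sigma> + n
    \<Longrightarrow> join_le I \<pi> \<sigma>"
proof (induction n arbitrary: \<pi>)
  case 0
  then show ?case by (simp add: join_le_def)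
next
  case (Suc n)
  from relpowp_Suc_D2[OF Suc.prems(1)] obtain \<pi>' where
    s: "cayley_adj I \<pi> \<pi>'" "(cayley_adj I ^^ n) \<pi>' \<sigma>" by blast
  have \<pi>': "\<pi>' permutes I" using cayley_adj_permutes[OF s(1) Suc.prems(2)] .
  have le: "num_orbits I \<pi>' \<le> num_orbits I \<sigma> + n" using num_orbits_le_steps[OF assms s(2) \<pi>'] .
  obtain a b where ab: "a \<in> I" "b \<in> I" "a \<noteq> b" "\<pi>' = \<pi> \<circ> transpose a b"
    using s(1) by (rule cayley_adjE)
  have ne: "orbit \<pi> a \<noteq> orbit \<pi> b"
    using split_num_orbits[OF assms Suc.prems(2) ab(1-3)] ab(4) le Suc.prems(3) by auto
  then have "join_step I \<pi> \<pi>'" unfolding join_step_def using ab by blast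
  moreover have "num_orbits I \<pi>' = num_orbits I \<sigma> + n"
    using join_num_orbits(1)[OF assms Suc.prems(2) ab(1,2) ne] Suc.prems(3) unfolding ab(4) by simp
  then have "join_le I \<pi>' \<sigma>" using Suc.IH[OF s(2) \<pi>'] by blast
  ultimately show ?case unfolding join_le_def by (rule converse_rtranclp_into_rtranclp)
qed

text \<open>
  A chain of \<open>n\<close> joins is a path of length \<open>n\<close>; it is shortest because \<open>n\<close> orbits cannot be lost in
  fewer steps.
\<close>
lemma join_le_imp:
  assumes "finite I" "join_le I \<pi> \<sigma>" "\<pi> permutes I"
  shows "\<sigma> permutes I \<and> refines I (orbit_partition I \<pi>) (orbit_partition I \<sigma>) \<and>
    num_orbits I \<pi> = num_orbits I \<sigma> + cayley_dist I \<pi> \<sigma>"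
proof -
  have "\<sigma> permutes I \<and> refines I (orbit_partition I \<pi>) (orbit_partition I \<sigma>) \<and>
    (\<exists>n. (cayley_adj I ^^ n) \<pi> \<sigma> \<and> num_orbits I \<pi> = num_orbits I \<sigma> + n)"
    using assms(2) unfolding join_le_def
  proof induction
    case base
    then show ?case using assms refines_refl partition_on_orbits relpowp_0_I by force
  next
    case (step \<tau> \<sigma>)
    then show ?case
      using join_step_imp[OF assms(1) _ step.hyps(2)]
      by (metis add_Suc_shift refines_trans relpowp_Suc_I)
  qed
  then show ?thesis
    using cayley_dist_le_steps[OF assms(1) _ _ assms(3)] num_orbits_le_dist[OF assms(1,3)]
    by (metis add_le_cancel_left le_antisym)
qed

lemma join_le_iff_dist:
  assumes "finite I" "\<pi> permutes I" "\<sigma> permutes I"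
  shows "join_le I \<pi> \<sigma> \<longleftrightarrow> num_orbits I \<pi> = num_orbits I \<sigma> + cayley_dist I \<pi> \<sigma>"
  using join_le_imp[OF assms(1) _ assms(2)]
    join_le_of_steps[OF assms(1) steps_of_cayley_dist[OF assms(1,3,2)] assms(2)] by blast

section \<open>Joining along a geodesic\<close>

text \<open>
  If \<open>\<Pi>(\<rho>)\<close> does not refine \<open>\<Pi>(\<pi>)\<close>, some \<open>\<rho> x\<close> lies outside the \<open>\<pi>\<close>-orbit of \<open>x\<close>.  Put
  \<open>b = \<pi>\<^sup>-\<^sup>1 (\<rho> x)\<close>.  Then \<open>x\<close> and \<open>b\<close> lie in different cycles of \<open>\<pi>\<close>, but \<open>\<rho>\<^sup>-\<^sup>1\<pi>\<close> maps \<open>b\<close> to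
  \<open>x\<close>.  So \<open>(x, b)\<close> joins two cycles of \<open>\<pi>\<close> while it splits a cycle of \<open>\<rho>\<^sup>-\<^sup>1\<pi>\<close>, which shortens the
  distance to \<open>\<rho>\<close>; and \<open>x\<close>, \<open>b\<close> are in the same block of the join, which therefore does not change.
  The process stops when \<open>\<Pi>(\<pi>)\<close> has become the join.
\<close>
lemma geodesic_point_over_join:
  assumes "finite I" "\<rho> permutes I"
  shows "\<pi> permutes I \<Longrightarrow> is_partition_join I (orbit_partition I \<pi>) (orbit_partition I \<rho>) R \<Longrightarrow>
    \<exists>\<sigma>. join_le I \<pi> \<sigma> \<and> orbit_partition I \<sigma> = R \<and>
      cayley_dist I \<pi> \<rho> = cayley_dist I \<pi> \<sigma> + cayley_dist I \<sigma> \<rho>"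
proof (induction "num_orbits I \<pi>" arbitrary: \<pi> rule: less_induct)
  case less
  note \<pi> = less.prems(1)
  have refs: "refines I (orbit_partition I \<pi>) R" "refines I (orbit_partition I \<rho>) R"
    using less.prems(2) by (auto simp: is_partition_join_def)
  then have R: "partition_on I R" by (auto simp: refines_def)
  show ?case
  proof (cases "refines I (orbit_partition I \<rho>) (orbit_partition I \<pi>)")
    case True
    then have "R = orbit_partition I \<pi>"
      using less.prems(2) refs(1) refines_refl[OF partition_on_orbits[OF assms(1) \<pi>]]
      unfolding is_partition_join_def by (meson refines_asym)
    then show ?thesis
      using cayley_dist_eq_0_iff[OF assms(1)] \<pi> by (intro exI[of _ \<pi>]) (auto simp: join_le_def)
  next
    case False
    then obtain z x where zx: "z \<in> I" "x \<in> orbit \<pi> z" "\<rho> x \<notin> orbit \<pi> z"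
      unfolding orbit_partition_refines_iff[OF assms partition_on_orbits[OF assms(1) \<pi>]]
      unfolding orbit_partition_def by blast
    moreover have "orbit \<pi> z = orbit \<pi> x" using zx(2) orbit_eq_iff[OF assms(1) \<pi>] by simp
    ultimately have x: "x \<in> I" "\<rho> x \<notin> orbit \<pi> x"
      using permutes_orbit_subset[OF \<pi> zx(1)] by auto
    define b where "b = inv \<pi> (\<rho> x)"
    have \<pi>b: "\<pi> b = \<rho> x" using \<pi> by (simp add: b_def permutes_inverses)
    have bI: "b \<in> I" using x \<pi> assms(2) by (simp add: b_def permutes_in_image permutes_inv)
    have ne: "orbit \<pi> x \<noteq> orbit \<pi> b"
      using x(2) \<pi>b orbit_eq_iff[OF assms(1) \<pi>] orbit_apply[OF assms(1) \<pi>] by metis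
    have \<kappa>: "inv \<rho> \<circ> \<pi> permutes I" using \<pi> assms(2) by (rule permutes_inv_comp)
    have "(inv \<rho> \<circ> \<pi>) b = x" using \<pi>b assms(2) by (simp add: permutes_inverses)
    then have \<kappa>eq: "orbit (inv \<rho> \<circ> \<pi>) x = orbit (inv \<rho> \<circ> \<pi>) b"
      using orbit_apply[OF assms(1) \<kappa>, of b] by simp
    have xb: "x \<noteq> b" using ne by auto
    let ?\<pi>' = "\<pi> \<circ> transpose x b"
    have js: "join_step I \<pi> ?\<pi>'" unfolding join_step_def using x bI ne by blast
    note js' = join_step_imp[OF assms(1) \<pi> js]
    have d: "cayley_dist I \<pi> \<rho> = Suc (cayley_dist I ?\<pi>' \<rho>)"
      using cayley_dist_transpose(1)[OF assms(1) \<pi> assms(2) x(1) bI xb \<kappa>eq] .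
    obtain B where B: "B \<in> R" "x \<in> B" using x(1) partition_onD1[OF R] by blast
    have "b \<in> B"
    proof -
      have "\<rho> x \<in> B" using orbit_partition_refines_iff[OF assms R] refs(2) B by blast
      moreover have "refines I (orbit_partition I (inv \<pi>)) R"
        using orbit_partition_inv[OF assms(1) \<pi>] refs(1) by simp
      ultimately show ?thesis
        unfolding b_def
        using orbit_partition_refines_iff[OF assms(1) permutes_inv[OF \<pi>] R] B by blast
    qed
    then have "refines I (orbit_partition I ?\<pi>') R"
      using refines_orbits_comp[OF assms(1) \<pi> permutes_swap_id[OF x(1) bI] refs(1)]
        refines_orbits_transpose[OF assms(1) R B] by blast
    then have "is_partition_join I (orbit_partition I ?\<pi>') (orbit_partition I \<rho>) R"
      using partition_join_coarsen_left[OF less.prems(2) js'(4)] by blast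
    then obtain \<sigma> where \<sigma>: "join_le I ?\<pi>' \<sigma>" "orbit_partition I \<sigma> = R"
        "cayley_dist I ?\<pi>' \<rho> = cayley_dist I ?\<pi>' \<sigma> + cayley_dist I \<sigma> \<rho>"
      using less.hyps js'(2,3) by (metis lessI)
    have le: "join_le I \<pi> \<sigma>"
      using js \<sigma>(1) unfolding join_le_def by (rule converse_rtranclp_into_rtranclp)
    have "num_orbits I \<pi> = num_orbits I \<sigma> + cayley_dist I \<pi> \<sigma>"
      "num_orbits I ?\<pi>' = num_orbits I \<sigma> + cayley_dist I ?\<pi>' \<sigma>"
      using join_le_imp[OF assms(1) le \<pi>] join_le_imp[OF assms(1) \<sigma>(1) js'(2)] by auto
    then show ?thesis using le \<sigma> d js'(3) by (intro exI[of _ \<sigma>]) auto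
  qed
qed

text \<open>
  The Euler characteristic of the hypermap defined by \<open>\<pi>\<close> and \<open>\<rho>\<^sup>-\<^sup>1\<close> is at most twice the number
  of its connected components, which are the blocks of \<open>R\<close>.  This follows from the point \<open>\<sigma>\<close> of the
  preceding lemma, since the remaining path from \<open>\<sigma>\<close> to \<open>\<rho>\<close> has to make up the difference of
  orbit numbers.
\<close>
lemma genus_inequality:
  assumes "finite I" "\<pi> permutes I" "\<rho> permutes I"
    and "is_partition_join I (orbit_partition I \<pi>) (orbit_partition I \<rho>) R"
  shows "num_orbits I \<pi> + num_orbits I \<rho> \<le> cayley_dist I \<pi> \<rho> + 2 * card R"
proof -
  obtain \<sigma> where \<sigma>: "join_le I \<pi> \<sigma>" "orbit_partition I \<sigma> = R"
      "cayley_dist I \<pi> \<rho> = cayley_dist I \<pi> \<sigma> + cayley_dist I \<sigma> \<rho>"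
    using geodesic_point_over_join[OF assms(1,3,2,4)] by blast
  have p: "\<sigma> permutes I" "num_orbits I \<pi> = num_orbits I \<sigma> + cayley_dist I \<pi> \<sigma>"
    using join_le_imp[OF assms(1) \<sigma>(1) assms(2)] by auto
  have "num_orbits I \<rho> \<le> num_orbits I \<sigma> + cayley_dist I \<sigma> \<rho>"
    using num_orbits_le_dist[OF assms(1,3) p(1)] cayley_dist_sym[OF assms(1,3) p(1)] by simp
  moreover have "num_orbits I \<sigma> = card R" using \<sigma>(2) by (simp add: num_orbits_def)
  ultimately show ?thesis using p \<sigma>(3) by linarith
qed

text \<open>
  Let \<open>\<pi>' = \<pi> (a, b)\<close> be the first join of the chain, so that the equation holds for \<open>\<pi>'\<close>, and
  \<open>#(\<pi>) = #(\<pi>') + 1\<close>.  By the genus inequality only \<open>\<le>\<close> is to be shown for \<open>\<pi>\<close>.  If \<open>a\<close> and \<open>b\<close> are in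
  the same block of \<open>R\<close>, then \<open>R\<close> is also the join for \<open>\<pi>'\<close>, and \<open>d(\<pi>, \<rho>) \<le> d(\<pi>', \<rho>) + 1\<close>
  suffices.  If they are in different blocks, passing to \<open>\<pi>'\<close> costs at most one block of the join.
  In this case \<open>a\<close> and \<open>b\<close> are also in different orbits of \<open>\<rho>\<^sup>-\<^sup>1\<pi>\<close>, because these orbits lie
  within blocks of \<open>R\<close>, so \<open>(a, b)\<close> increases the distance: \<open>d(\<pi>, \<rho>) = d(\<pi>', \<rho>) - 1\<close>.
\<close>
lemma upper_bound_imp_genus_equality:
  assumes "finite I" "\<rho> permutes I" "join_le I \<rho> \<sigma>"
  shows "join_le I \<pi> \<sigma> \<Longrightarrow> \<pi> permutes I \<Longrightarrow>
    is_partition_join I (orbit_partition I \<pi>) (orbit_partition I \<rho>) R \<Longrightarrow>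
    cayley_dist I \<pi> \<rho> + 2 * card R = num_orbits I \<pi> + num_orbits I \<rho>"
  unfolding join_le_def
proof (induction arbitrary: R rule: converse_rtranclp_induct)
  case base
  note \<rho> = join_le_imp[OF assms(1,3,2)]
  have "R = orbit_partition I \<sigma>"
    using base(2) \<rho> refines_refl[OF partition_on_orbits[OF assms(1) base(1)]]
    unfolding is_partition_join_def by (meson refines_asym)
  then have "card R = num_orbits I \<sigma>" by (simp add: num_orbits_def)
  then show ?case using \<rho> cayley_dist_sym[OF assms(1,2) base(1)] by simp
next
  case (step \<pi> \<pi>')
  note \<pi> = step.prems(1)
  note js = join_step_imp[OF assms(1) \<pi> step.hyps(1)]
  have refs: "refines I (orbit_partition I \<pi>) R" "refines I (orbit_partition I \<rho>) R"
    using step.prems(2) by (auto simp: is_partition_join_def)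
  then have R: "partition_on I R" by (auto simp: refines_def)
  obtain a b where ab: "a \<in> I" "b \<in> I" "orbit \<pi> a \<noteq> orbit \<pi> b" "\<pi>' = \<pi> \<circ> transpose a b"
    using step.hyps(1) unfolding join_step_def by blast
  have anb: "a \<noteq> b" using ab by auto
  have t: "transpose a b permutes I" using ab by (intro permutes_swap_id)
  obtain A B where AB: "A \<in> R" "B \<in> R" "a \<in> A" "b \<in> B"
    using partition_onD1[OF R] ab by blast
  define R' where "R' = partition_join I (orbit_partition I \<pi>') (orbit_partition I \<rho>)"
  have R': "is_partition_join I (orbit_partition I \<pi>') (orbit_partition I \<rho>) R'"
    unfolding R'_def using assms js(2) by (intro partition_join partition_on_orbits)
  have IH: "cayley_dist I \<pi>' \<rho> + 2 * card R' = num_orbits I \<pi>' + num_orbits I \<rho>"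
    using step.IH js(2) R' by blast
  have lower: "num_orbits I \<pi> + num_orbits I \<rho> \<le> cayley_dist I \<pi> \<rho> + 2 * card R"
    using genus_inequality[OF assms(1) \<pi> assms(2) step.prems(2)] .
  have "cayley_dist I \<pi> \<rho> + 2 * card R \<le> num_orbits I \<pi> + num_orbits I \<rho>"
  proof (cases "A = B")
    case True
    then have "b \<in> A" using AB(4) by simp
    then have "refines I (orbit_partition I \<pi>') R"
      unfolding ab(4)
      using refines_orbits_comp[OF assms(1) \<pi> t refs(1)]
        refines_orbits_transpose[OF assms(1) R AB(1,3)] by blast
    then have "R' = R"
      using partition_join_coarsen_left[OF step.prems(2) js(4)] R' is_partition_join_unique by blast
    moreover have "cayley_dist I \<pi> \<rho> \<le> Suc (cayley_dist I \<pi>' \<rho>)"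
      using cayley_dist_le_adj[OF assms(1) \<pi> assms(2) js(1)] .
    ultimately show ?thesis using IH js(3) by simp
  next
    case False
    (* ?M is a common coarsening of the orbit partitions of \<pi>' and \<rho>, so R' refines it and has
       at least card R - 1 blocks. *)
    let ?M = "insert (A \<union> B) (R - {A, B})"
    note M = merge_blocks[OF assms(1) R AB(1,2) False]
    then have Mpart: "partition_on I ?M" by (simp add: refines_def)
    have "refines I (orbit_partition I \<pi>') ?M"
      unfolding ab(4)
      using refines_orbits_comp[OF assms(1) \<pi> t refines_trans[OF refs(1) M(1)]]
        refines_orbits_transpose[OF assms(1) Mpart, of "A \<union> B" a b] AB(3,4) by blast
    then have "refines I R' ?M"
      using R' refines_trans[OF refs(2) M(1)] unfolding is_partition_join_def by blast
    then have card: "card R \<le> Suc (card R')"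
      using refines_card_le[OF assms(1)] M(2) by fastforce
    have "refines I (orbit_partition I (inv \<rho> \<circ> \<pi>)) R"
      using refines_orbits_comp[OF assms(1) permutes_inv[OF assms(2)] \<pi> _ refs(1)]
        orbit_partition_inv[OF assms(1,2)] refs(2) by simp
    then obtain C where C: "C \<in> R" "orbit (inv \<rho> \<circ> \<pi>) a \<subseteq> C"
      using ab(1) unfolding refines_def orbit_partition_def by blast
    have \<kappa>: "inv \<rho> \<circ> \<pi> permutes I" using \<pi> assms(2) by (rule permutes_inv_comp)
    have "orbit (inv \<rho> \<circ> \<pi>) a \<noteq> orbit (inv \<rho> \<circ> \<pi>) b"
    proof
      assume "orbit (inv \<rho> \<circ> \<pi>) a = orbit (inv \<rho> \<circ> \<pi>) b"
      then have "a \<in> C" "b \<in> C" using C self_in_orbit[OF assms(1) \<kappa>] by blast+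
      then show False
        using AB C(1) False block_unique[OF R] by metis
    qed
    then have "cayley_dist I \<pi>' \<rho> = Suc (cayley_dist I \<pi> \<rho>)"
      using cayley_dist_transpose(2)[OF assms(1) \<pi> assms(2) ab(1,2) anb] ab(4) by simp
    then show ?thesis using IH js(3) card by simp
  qed
  with lower show ?case by simp
qed

text \<open>
  Planarity is defined by \<open>\<pi>\<rho>\<^sup>-\<^sup>1\<close>, the distance by its conjugate \<open>\<rho>\<^sup>-\<^sup>1\<pi>\<close>.
\<close>
lemma planar_on_iff_genus_equality:
  assumes "finite I" "\<pi> permutes I" "\<rho> permutes I"
  shows "planar_on I \<pi> (inv \<rho>) \<longleftrightarrow>
    cayley_dist I \<pi> \<rho> + 2 * card (partition_join I (orbit_partition I \<pi>) (orbit_partition I \<rho>))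
      = num_orbits I \<pi> + num_orbits I \<rho>"
proof -
  have "num_orbits I (\<pi> \<circ> inv \<rho>) + cayley_dist I \<pi> \<rho> = card I"
    using cayley_dist_add_num_orbits[OF assms(1), of \<pi> \<rho>]
      num_orbits_comp_commute[OF assms(1,2) permutes_inv[OF assms(3)]] by simp
  moreover have "num_orbits I (inv \<rho>) = num_orbits I \<rho>"
    using orbit_partition_inv[OF assms(1,3)] by (simp add: num_orbits_def)
  ultimately show ?thesis
    unfolding planar_on_def orbit_partition_inv[OF assms(1,3)] by linarith
qed

theorem lemma4p7:
  fixes I :: "'a set" and \<pi> \<rho> :: "'a \<Rightarrow> 'a"
  assumes "finite I" and "\<pi> permutes I" and "\<rho> permutes I"
  shows "((\<exists>\<sigma>. is_upper_bound I \<pi> \<rho> \<sigma>) \<longleftrightarrow>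
            (\<exists>\<sigma>. is_upper_bound I \<pi> \<rho> \<sigma> \<and>
               partition_join I (orbit_partition I \<pi>) (orbit_partition I \<rho>) = orbit_partition I \<sigma>))
       \<and> ((\<exists>\<sigma>. is_upper_bound I \<pi> \<rho> \<sigma>) \<longleftrightarrow>
            (\<exists>\<sigma> p. is_upper_bound I \<pi> \<rho> \<sigma> \<and> is_geodesic I \<pi> \<rho> p \<and> \<sigma> \<in> set p))
       \<and> ((\<exists>\<sigma>. is_upper_bound I \<pi> \<rho> \<sigma>) \<longleftrightarrow> planar_on I \<pi> (inv \<rho>))"
proof -
  let ?R = "partition_join I (orbit_partition I \<pi>) (orbit_partition I \<rho>)"
  have R: "is_partition_join I (orbit_partition I \<pi>) (orbit_partition I \<rho>) ?R"
    using assms by (intro partition_join partition_on_orbits)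
  obtain \<sigma> where \<sigma>: "join_le I \<pi> \<sigma>" "orbit_partition I \<sigma> = ?R"
      "cayley_dist I \<pi> \<rho> = cayley_dist I \<pi> \<sigma> + cayley_dist I \<sigma> \<rho>"
    using geodesic_point_over_join[OF assms(1,3,2) R] by blast
  have p: "\<sigma> permutes I" "num_orbits I \<pi> = num_orbits I \<sigma> + cayley_dist I \<pi> \<sigma>"
    using join_le_imp[OF assms(1) \<sigma>(1) assms(2)] by auto
  have "num_orbits I \<sigma> = card ?R" using \<sigma>(2) by (simp add: num_orbits_def)
  then have "planar_on I \<pi> (inv \<rho>) \<longleftrightarrow> num_orbits I \<rho> = num_orbits I \<sigma> + cayley_dist I \<rho> \<sigma>"
    unfolding planar_on_iff_genus_equality[OF assms]
    using p(2) \<sigma>(3) cayley_dist_sym[OF assms(1,3) p(1)] by linarith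
  then have planar_iff: "planar_on I \<pi> (inv \<rho>) \<longleftrightarrow> is_upper_bound I \<pi> \<rho> \<sigma>"
    using join_le_iff_dist[OF assms(1,3) p(1)] p(1) \<sigma>(1) by (simp add: is_upper_bound_def)
  have "planar_on I \<pi> (inv \<rho>)" if "is_upper_bound I \<pi> \<rho> \<tau>" for \<tau>
    using that upper_bound_imp_genus_equality[OF assms(1,3) _ _ assms(2) R]
    unfolding planar_on_iff_genus_equality[OF assms] is_upper_bound_def by blast
  moreover obtain p where "is_geodesic I \<pi> \<rho> p" "\<sigma> \<in> set p"
    using geodesic_through[OF assms(1,2) p(1) assms(3) \<sigma>(3)] by blast
  ultimately show ?thesis using planar_iff \<sigma>(2) by metis
qed

end
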